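(* Let $k$ be a field, $S=k[[x,y]]$, $\mathfrak{n}=(x,y)S$, and $R=S/(f)$, where $f\in\mathfrak{n}$ has order $\mathrm{ord}_S(f)=e$. Let $\mathfrak{m}=(x,y)R$ and let $z\in\mathfrak{m}$ be such that its initial form $z^{*}$ is a regular element of $\mathrm{gr}_{\mathfrak{m}}(R)$. If $z$ is a witness to $\mathrm{g}\ell\ell(R)$, then $$\mathrm{g}\ell\ell(R)=\mathrm{ord}_R(z)+e-1.$$
   Context: For $f\in S$, $\mathrm{ord}_S(f)=r$ means $f\in\mathfrak{n}^r\setminus\mathfrak{n}^{r+1}$; for $z\in R$, $\mathrm{ord}_R(z)=r$ means $z\in\mathfrak{m}^r\setminus\mathfrak{m}^{r+1}$. The associated graded ring is $\mathrm{gr}_{\mathfrak{m}}(R)=\bigoplus_{i\ge 0}\mathfrak{m}^i/\mathfrak{m}^{i+1}$, and if $\mathrm{ord}_R(z)=r$ then $z^*$ is the class of $z$ in $\mathfrak{m}^r/\mathfrak{m}^{r+1}$. The generalized Loewy length $\mathrm{g}\ell\ell(R)$ of a local ring $(R,\mathfrak{m})$ is the smallest positive integer $n$ for which $\mathfrak{m}^n$ is contained in the ideal generated by some system of parameters of $R$. A system of parameters $x_1,\dots,x_d\in\mathfrak{m}$ is a witness to $g=\mathrm{g}\ell\ell(R)$ if $\mathfrak{m}^g\subseteq(x_1,\dots,x_d)$; here $d=\dim R=1$. *)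

theory Defs
  imports
    "HOL-Algebra.Ideal_Product"
    "HOL-Algebra.Algebraic_Closure_Type"
    "HOL-Computational_Algebra.Formal_Power_Series"
    "HOL-Library.Extended_Nat"
begin

section \<open>Powers of an ideal and orders of elements\<close>

abbreviation ideal_pow :: "('a, 'b) ring_scheme \<Rightarrow> 'a set \<Rightarrow> nat \<Rightarrow> 'a set"
  where "ideal_pow R I n \<equiv> I [^]\<^bsub>ideals_set R\<^esub> n"

text \<open>\<open>has_order R I z r\<close> says that \<open>z\<close> has order \<open>r\<close>. It is a relation because elements
  of \<open>\<Inter>n. ideal_pow R I n\<close>, such as zero, have no order.\<close>

definition has_order :: "('a, 'b) ring_scheme \<Rightarrow> 'a set \<Rightarrow> 'a \<Rightarrow> nat \<Rightarrow> bool"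
  where "has_order R I z r \<longleftrightarrow> z \<in> ideal_pow R I r - ideal_pow R I (Suc r)"


section \<open>The associated graded ring\<close>

text \<open>\<open>graded_quot R I i\<close> is the ring \<open>R / I\<^sup>i\<^sup>+\<^sup>1\<close>; the graded piece \<open>I\<^sup>i / I\<^sup>i\<^sup>+\<^sup>1\<close> is
  the subset \<open>graded_piece R I i\<close> of its carrier, with the addition of that ring.\<close>

abbreviation graded_quot :: "('a, 'b) ring_scheme \<Rightarrow> 'a set \<Rightarrow> nat \<Rightarrow> 'a set ring"
  where "graded_quot R I i \<equiv> R Quot (ideal_pow R I (Suc i))"

definition graded_piece :: "('a, 'b) ring_scheme \<Rightarrow> 'a set \<Rightarrow> nat \<Rightarrow> 'a set set"
  where "graded_piece R I i = (\<lambda>a. ideal_pow R I (Suc i) +>\<^bsub>R\<^esub> a) ` ideal_pow R I i"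

text \<open>Elements of the direct sum are finitely supported sequences of cosets. On homogeneous
  components, multiplication sends the classes of \<open>a\<close> in \<open>I\<^sup>i / I\<^sup>i\<^sup>+\<^sup>1\<close> and of \<open>b\<close> in
  \<open>I\<^sup>j / I\<^sup>j\<^sup>+\<^sup>1\<close> to the class of \<open>a b\<close> in \<open>I\<^sup>i\<^sup>+\<^sup>j / I\<^sup>i\<^sup>+\<^sup>j\<^sup>+\<^sup>1\<close>: this is
  \<^const>\<open>rcoset_mult\<close> modulo \<open>I\<^sup>i\<^sup>+\<^sup>j\<^sup>+\<^sup>1\<close>, which is applied here to cosets of larger ideals
  (see \<open>graded_mult_coset\<close> below).\<close>

definition assoc_graded :: "('a, 'b) ring_scheme \<Rightarrow> 'a set \<Rightarrow> (nat \<Rightarrow> 'a set) ring"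
  where "assoc_graded R I =
    \<lparr>carrier = {a. (\<forall>i. a i \<in> graded_piece R I i) \<and>
                   finite {i. a i \<noteq> \<zero>\<^bsub>graded_quot R I i\<^esub>}},
     monoid.mult = (\<lambda>a b n. \<Oplus>\<^bsub>graded_quot R I n\<^esub>i\<in>{..n}.
                       rcoset_mult R (ideal_pow R I (Suc n)) (a i) (b (n - i))),
     one = (\<lambda>i. if i = 0 then \<one>\<^bsub>graded_quot R I i\<^esub> else \<zero>\<^bsub>graded_quot R I i\<^esub>),
     zero = (\<lambda>i. \<zero>\<^bsub>graded_quot R I i\<^esub>),
     add = (\<lambda>a b i. a i \<oplus>\<^bsub>graded_quot R I i\<^esub> b i)\<rparr>"

text \<open>For \<open>z\<close> without an order this is the zero of \<^const>\<open>assoc_graded\<close>.\<close>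

definition initial_form :: "('a, 'b) ring_scheme \<Rightarrow> 'a set \<Rightarrow> 'a \<Rightarrow> nat \<Rightarrow> 'a set"
  where "initial_form R I z =
    (\<lambda>i. if has_order R I z i then ideal_pow R I (Suc i) +>\<^bsub>R\<^esub> z
         else \<zero>\<^bsub>graded_quot R I i\<^esub>)"

definition regular_element :: "('a, 'b) ring_scheme \<Rightarrow> 'a \<Rightarrow> bool"
  where "regular_element A a \<longleftrightarrow>
    a \<in> carrier A \<and> (\<forall>b\<in>carrier A. a \<otimes>\<^bsub>A\<^esub> b = \<zero>\<^bsub>A\<^esub> \<longrightarrow> b = \<zero>\<^bsub>A\<^esub>)"

lemma (in cring) ideal_pow_ideal: "ideal I R \<Longrightarrow> ideal (ideal_pow R I n) R"
  using monoid.nat_pow_closed[OF comm_monoid.axioms(1)[OF ideals_set_is_comm_monoid], of I n]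
  by (simp add: ideals_set_def)

lemma (in cring) ideal_pow_mult:
  assumes "ideal I R" "a \<in> ideal_pow R I i" "b \<in> ideal_pow R I j"
  shows "a \<otimes> b \<in> ideal_pow R I (i + j)"
proof -
  have "ideal_pow R I (i + j) = ideal_prod R (ideal_pow R I i) (ideal_pow R I j)"
    using monoid.nat_pow_mult[OF comm_monoid.axioms(1)[OF ideals_set_is_comm_monoid], of I i j]
      assms(1)
    by (simp add: ideals_set_def)
  then show ?thesis
    using assms(2,3) by (simp add: ideal_prod.prod)
qed

lemma (in cring) graded_mult_coset:
  assumes I: "ideal I R" and a: "a \<in> ideal_pow R I i" and b: "b \<in> ideal_pow R I j"
  shows "rcoset_mult R (ideal_pow R I (Suc (i + j)))
           (ideal_pow R I (Suc i) +> a) (ideal_pow R I (Suc j) +> b) =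
         ideal_pow R I (Suc (i + j)) +> (a \<otimes> b)"
proof -
  let ?J = "ideal_pow R I (Suc (i + j))"
  interpret J: ideal ?J R using ideal_pow_ideal[OF I] .
  interpret Ii: ideal "ideal_pow R I i" R using ideal_pow_ideal[OF I] .
  interpret Ij: ideal "ideal_pow R I j" R using ideal_pow_ideal[OF I] .
  interpret Ui: ideal "ideal_pow R I (Suc i)" R using ideal_pow_ideal[OF I] .
  interpret Uj: ideal "ideal_pow R I (Suc j)" R using ideal_pow_ideal[OF I] .
  have ac: "a \<in> carrier R" and bc: "b \<in> carrier R"
    using a b Ii.Icarr Ij.Icarr by auto
  have step: "?J +> (p \<otimes> q) = ?J +> (a \<otimes> b)"
    if p: "p \<in> ideal_pow R I (Suc i) +> a" and q: "q \<in> ideal_pow R I (Suc j) +> b" for p q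
  proof -
    obtain u where u: "u \<in> ideal_pow R I (Suc i)" "p = u \<oplus> a"
      using p by (auto simp: a_r_coset_def')
    obtain v where v: "v \<in> ideal_pow R I (Suc j)" "q = v \<oplus> b"
      using q by (auto simp: a_r_coset_def')
    have uc: "u \<in> carrier R" and vc: "v \<in> carrier R"
      using u v Ui.Icarr Uj.Icarr by auto
    have 1: "u \<otimes> b \<in> ?J" using ideal_pow_mult[OF I u(1) b] by simp
    have 2: "a \<otimes> v \<in> ?J" using ideal_pow_mult[OF I a v(1)] by simp
    have "u \<otimes> v \<in> ideal_prod R ?J I"
      using ideal_pow_mult[OF I u(1) v(1)] by (simp add: ideals_set_def)
    then have 3: "u \<otimes> v \<in> ?J"
      using ideal_prod_inter[OF ideal_pow_ideal[OF I, of "Suc (i + j)"] I] by blast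
    have "p \<otimes> q = (u \<otimes> v \<oplus> u \<otimes> b \<oplus> a \<otimes> v) \<oplus> a \<otimes> b"
      unfolding u v using ac bc uc vc by algebra
    moreover have "u \<otimes> v \<oplus> u \<otimes> b \<oplus> a \<otimes> v \<in> ?J"
      by (intro J.a_closed 1 2 3)
    ultimately have "p \<otimes> q \<in> ?J +> (a \<otimes> b)"
      by (auto simp: a_r_coset_def')
    then show ?thesis
      using a_repr_independence[OF _ _ J.a_subgroup, of "p \<otimes> q" "a \<otimes> b"] ac bc
      by simp
  qed
  have "a \<in> ideal_pow R I (Suc i) +> a" "b \<in> ideal_pow R I (Suc j) +> b"
    using Ui.zero_closed Uj.zero_closed l_zero[OF ac] l_zero[OF bc]
    unfolding a_r_coset_def' by (blast intro: sym)+
  then show ?thesis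
    unfolding rcoset_mult_def using step by blast
qed


section \<open>Systems of parameters and the generalized Loewy length\<close>

definition krull_dim :: "('a, 'b) ring_scheme \<Rightarrow> enat"
  where "krull_dim R = Sup {enat n |n. \<exists>P :: nat \<Rightarrow> 'a set.
    (\<forall>i\<le>n. primeideal (P i) R) \<and> (\<forall>i<n. P i \<subset> P (Suc i))}"

definition radical :: "('a, 'b) ring_scheme \<Rightarrow> 'a set \<Rightarrow> 'a set"
  where "radical R I = {a \<in> carrier R. \<exists>n::nat. a [^]\<^bsub>R\<^esub> n \<in> I}"

definition primary_ideal :: "'a set \<Rightarrow> ('a, 'b) ring_scheme \<Rightarrow> bool"
  where "primary_ideal Q R \<longleftrightarrow> ideal Q R \<and> Q \<noteq> carrier R \<and>
    (\<forall>a\<in>carrier R. \<forall>b\<in>carrier R. a \<otimes>\<^bsub>R\<^esub> b \<in> Q \<longrightarrow> a \<in> Q \<or> b \<in> radical R Q)"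

text \<open>In the following definitions \<open>M\<close> stands for the maximal ideal of the local ring \<open>R\<close>.\<close>

definition system_of_parameters :: "('a, 'b) ring_scheme \<Rightarrow> 'a set \<Rightarrow> 'a list \<Rightarrow> bool"
  where "system_of_parameters R M xs \<longleftrightarrow>
    enat (length xs) = krull_dim R \<and> set xs \<subseteq> M \<and>
    primary_ideal (genideal R (set xs)) R \<and> radical R (genideal R (set xs)) = M"

definition gen_loewy_length :: "('a, 'b) ring_scheme \<Rightarrow> 'a set \<Rightarrow> nat"
  where "gen_loewy_length R M =
    (LEAST n. 0 < n \<and>
      (\<exists>xs. system_of_parameters R M xs \<and> ideal_pow R M n \<subseteq> genideal R (set xs)))"

definition loewy_witness :: "('a, 'b) ring_scheme \<Rightarrow> 'a set \<Rightarrow> 'a list \<Rightarrow> bool"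
  where "loewy_witness R M xs \<longleftrightarrow> system_of_parameters R M xs \<and>
    ideal_pow R M (gen_loewy_length R M) \<subseteq> genideal R (set xs)"


section \<open>Power series in two variables and plane curve rings\<close>

text \<open>\<open>k[[x, y]]\<close> is represented as \<open>k[[x]][[y]]\<close>.\<close>

definition kxy :: "'k::field fps fps ring"
  where "kxy = ring_of_type_algebra"

definition var_x :: "'k::field fps fps"
  where "var_x = fps_const fps_X"

definition var_y :: "'k::field fps fps"
  where "var_y = fps_X"

definition kxy_max :: "'k::field fps fps set"
  where "kxy_max = genideal kxy {var_x, var_y}"

definition curve_ring :: "'k::field fps fps \<Rightarrow> 'k fps fps set ring"
  where "curve_ring f = kxy Quot (genideal kxy {f})"

definition curve_max :: "'k::field fps fps \<Rightarrow> 'k fps fps set set"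
  where "curve_max f = genideal (curve_ring f)
    {genideal kxy {f} +>\<^bsub>kxy\<^esub> var_x, genideal kxy {f} +>\<^bsub>kxy\<^esub> var_y}"

end

theory Submission
  imports Defs
begin

text \<open>
  Lift \<open>z\<close> to a series \<open>w\<close> of order \<open>r\<close>, and let \<open>W\<close> and \<open>F\<close> be the initial forms of \<open>w\<close> and \<open>f\<close>, of
  degrees \<open>r\<close> and \<open>e\<close>; write \<open>n\<close> and \<open>m\<close> for the maximal ideals of \<open>S = k[[x, y]]\<close> and of \<open>R = S/(f)\<close>.
  The inclusion of \<open>m\<^sup>d\<close> in \<open>zR\<close> amounts to that of \<open>n\<^sup>d\<close> in \<open>(w, f)\<close>. The theorem holds because
  \<open>d = r + e - 1\<close> is the threshold at which the latter begins to be true: it is the first degree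
  in which \<open>k[x, y]/(W, F)\<close> vanishes.

  Regularity of the initial form of \<open>z\<close> makes \<open>W\<close> and \<open>F\<close> coprime, that is, \<open>A W + B F = 0\<close> with
  \<open>deg A < e\<close> and \<open>deg B < r\<close> has only the trivial solution (\<open>initial_forms_coprime\<close>). The forms
  \<open>A\<close>, \<open>B\<close> of degrees \<open>e - 1\<close>, \<open>r - 1\<close> and the forms of degree \<open>r + e - 1\<close> make up spaces of the same
  dimension \<open>r + e\<close>, and so every form of degree \<open>r + e - 1\<close> is \<open>A W + B F\<close>. Hence \<open>n\<^sup>d\<close> lies in
  \<open>(w, f) + n\<^bsup>d+1\<^esup>\<close> for \<open>d \<ge> r + e - 1\<close>. As \<open>z\<close> is a witness, some power of \<open>n\<close> lies in \<open>(w, f)\<close>, and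
  iterating shows \<open>n\<^bsup>r+e-1\<^esup> \<subseteq> (w, f)\<close> (\<open>combinations_contain_order_ge\<close>); since \<open>z\<close> is a system of
  parameters, the generalized Loewy length is at most \<open>r + e - 1\<close>.

  Conversely, suppose \<open>n\<^sup>d \<subseteq> (w, f)\<close> with \<open>d = r + e - 2\<close>. In \<open>w a + f b\<close> of order at least \<open>d\<close>,
  regularity lets \<open>a\<close> be chosen of order at least \<open>e - 2\<close>, and then \<open>b\<close> has order at least \<open>r - 2\<close>. All
  forms of degree \<open>d\<close>, a space of dimension \<open>r + e - 1\<close>, would then come from pairs of cofactors
  filling only dimension \<open>(e - 1) + (r - 1)\<close>, which is impossible (\<open>not_all_combinations\<close>). A
  witness therefore has \<open>m\<^sup>g \<subseteq> zR\<close> only for \<open>g \<ge> r + e - 1\<close>.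
\<close>

section \<open>The Sylvester map\<close>

abbreviation pcoeff :: "'a::zero poly \<Rightarrow> nat \<Rightarrow> 'a" where "pcoeff \<equiv> Polynomial.coeff"

text \<open>These model the forms of degree \<open>n - 1\<close> in two variables, dehomogenised. Bounding the
  coefficients instead of the degree keeps the zero space \<open>n = 0\<close> in the same pattern.\<close>
definition polys_below :: "nat \<Rightarrow> 'k::field poly set"
  where "polys_below n = {p. \<forall>j\<ge>n. pcoeff p j = 0}"

lemma polys_below_mult:
  assumes "p \<in> polys_below m" "q \<in> polys_below (Suc n)"
  shows "p * q \<in> polys_below (m + n)"
proof -
  have "pcoeff p i * pcoeff q (j - i) = 0" if "m + n \<le> j" "i \<le> j" for i j
    using assms that by (cases "m \<le> i") (auto simp: polys_below_def)
  then show ?thesis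
    by (auto simp: polys_below_def coeff_mult intro!: sum.neutral)
qed

interpretation poly_space: vector_space "smult :: 'k::field \<Rightarrow> 'k poly \<Rightarrow> 'k poly"
  by unfold_locales (simp_all add: smult_add_right smult_add_left)

interpretation poly_space_pair: vector_space_pair
  "smult :: 'k::field \<Rightarrow> 'k poly \<Rightarrow> 'k poly" "smult :: 'k::field \<Rightarrow> 'k poly \<Rightarrow> 'k poly" ..

abbreviation low_monoms :: "nat \<Rightarrow> 'k::field poly set"
  where "low_monoms n \<equiv> Polynomial.monom 1 ` {..<n}"

lemma span_low_monoms: "poly_space.span (low_monoms n) = (polys_below n :: 'k::field poly set)"
proof
  show "poly_space.span (low_monoms n) \<subseteq> (polys_below n :: 'k poly set)"
  proof (rule poly_space.span_minimal)
    show "poly_space.subspace (polys_below n :: 'k poly set)"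
      by (rule poly_space.subspaceI) (auto simp: polys_below_def)
  qed (auto simp: polys_below_def)
  show "(polys_below n :: 'k poly set) \<subseteq> poly_space.span (low_monoms n)"
  proof
    fix p :: "'k poly" assume p: "p \<in> polys_below n"
    have "p = (\<Sum>j<n. smult (pcoeff p j) (Polynomial.monom 1 j))"
      using p by (auto simp: poly_eq_iff coeff_sum polys_below_def if_distrib sum.delta cong: if_cong)
    also have "\<dots> \<in> poly_space.span (low_monoms n)"
      by (intro poly_space.span_sum poly_space.span_scale poly_space.span_base) auto
    finally show "p \<in> poly_space.span (low_monoms n)" .
  qed
qed

lemma card_low_monoms: "card (low_monoms n :: 'k::field poly set) = n"
  by (subst card_image) (auto simp: inj_on_def monom_eq_iff')

lemma independent_low_monoms: "poly_space.independent (low_monoms n :: 'k::field poly set)"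
proof (induction n)
  case (Suc n)
  have "Polynomial.monom 1 n \<notin> (polys_below n :: 'k poly set)"
    by (auto simp: polys_below_def)
  then show ?case
    using Suc by (simp add: lessThan_Suc poly_space.independent_insertI span_low_monoms)
qed (simp add: poly_space.independent_empty)

abbreviation poly_linear :: "('k::field poly \<Rightarrow> 'k poly) \<Rightarrow> bool"
  where "poly_linear \<equiv> Vector_Spaces.linear smult smult"

text \<open>An image of an \<open>n\<close>-dimensional space cannot contain the \<open>n + 1\<close> independent monomials
  of degree at most \<open>n\<close>.\<close>

lemma linear_not_onto_larger:
  fixes L :: "'k::field poly \<Rightarrow> 'k poly"
  assumes L: "poly_linear L"
  shows "\<not> polys_below (Suc n) \<subseteq> L ` polys_below n"
proof
  assume "polys_below (Suc n) \<subseteq> L ` polys_below n"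
  also have "L ` polys_below n = poly_space.span (L ` low_monoms n)"
    using L by (simp add: poly_space_pair.linear_span_image span_low_monoms)
  finally have "low_monoms (Suc n) \<subseteq> poly_space.span (L ` low_monoms n)"
    using poly_space.span_superset[of "low_monoms (Suc n) :: 'k poly set"]
    by (simp only: span_low_monoms[of "Suc n"] subset_trans)
  then have "card (low_monoms (Suc n) :: 'k poly set) \<le> card (L ` low_monoms n)"
    using poly_space.independent_span_bound[OF _ independent_low_monoms, of "L ` low_monoms n"]
    by blast
  also have "\<dots> \<le> card (low_monoms n :: 'k poly set)"
    by (rule card_image_le) simp
  finally show False
    by (simp add: card_low_monoms)
qed

text \<open>If \<open>p\<close> were missed, adjoining it to the images of the monomials would give \<open>n + 1\<close>
  independent vectors in an \<open>n\<close>-dimensional space.\<close>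

lemma linear_injective_onto:
  fixes L :: "'k::field poly \<Rightarrow> 'k poly"
  assumes L: "poly_linear L"
    and maps: "L ` polys_below n \<subseteq> polys_below n"
    and ker: "\<And>p. p \<in> polys_below n \<Longrightarrow> L p = 0 \<Longrightarrow> p = 0"
  shows "polys_below n \<subseteq> L ` polys_below n"
proof (rule ccontr)
  let ?B = "low_monoms n :: 'k poly set"
  assume "\<not> polys_below n \<subseteq> L ` polys_below n"
  then obtain p where p: "p \<in> polys_below n" "p \<notin> L ` polys_below n"
    by blast
  have inj: "inj_on L (poly_space.span ?B)"
    unfolding poly_space_pair.linear_inj_on_iff_eq_0[OF L poly_space.subspace_span]
    using ker by (simp add: span_low_monoms)
  have img: "poly_space.span (L ` ?B) = L ` polys_below n"
    using L by (simp add: poly_space_pair.linear_span_image span_low_monoms)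
  have ind: "poly_space.independent (insert p (L ` ?B))"
    using p img poly_space_pair.linear_independent_injective_image[OF L independent_low_monoms inj]
    by (intro poly_space.independent_insertI) auto
  have sub: "insert p (L ` ?B) \<subseteq> poly_space.span ?B"
    using p maps img poly_space.span_superset[of "L ` ?B"] by (auto simp: span_low_monoms)
  have "p \<notin> L ` ?B"
    using p img poly_space.span_superset[of "L ` ?B"] by blast
  moreover have "card (L ` ?B) = n"
    using inj_on_subset[OF inj poly_space.span_superset] by (simp add: card_image card_low_monoms)
  ultimately have "card (insert p (L ` ?B)) = Suc n"
    by simp
  then show False
    using poly_space.independent_span_bound[OF _ ind sub] by (simp add: card_low_monoms)
qed

text \<open>This is the Sylvester map \<open>(A, B) \<mapsto> A W + B F\<close>. The pair is packed into the one polynomial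
  \<open>A + Y\<^sup>e B\<close>, so that the two cofactor spaces become \<^term>\<open>polys_below (r + e)\<close> and source
  and target of the map coincide.\<close>
definition sylvester_map :: "nat \<Rightarrow> 'k::field poly \<Rightarrow> 'k poly \<Rightarrow> 'k poly \<Rightarrow> 'k poly"
  where "sylvester_map e W F p = poly_cutoff e p * W + poly_shift e p * F"

lemma linear_sylvester_map: "poly_linear (sylvester_map e W F)"
proof -
  have "poly_cutoff e (p + q) = poly_cutoff e p + poly_cutoff e q"
    "poly_shift e (p + q) = poly_shift e p + poly_shift e q"
    "poly_cutoff e (smult c p) = smult c (poly_cutoff e p)"
    "poly_shift e (smult c p) = smult c (poly_shift e p)" for c and p q :: "'a poly"
    by (simp_all add: poly_eq_iff coeff_poly_cutoff coeff_poly_shift)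
  then show ?thesis
    by (unfold_locales) (simp_all add: sylvester_map_def algebra_simps smult_add_right)
qed

lemma sylvester_map_combine:
  assumes "A \<in> polys_below e"
  shows "sylvester_map e W F (A + Polynomial.monom 1 e * B) = A * W + B * F"
proof -
  have "poly_cutoff e (A + Polynomial.monom 1 e * B) = A"
    "poly_shift e (A + Polynomial.monom 1 e * B) = B"
    using assms
    by (auto simp: poly_eq_iff coeff_poly_cutoff coeff_poly_shift coeff_monom_mult polys_below_def)
  then show ?thesis
    by (simp add: sylvester_map_def)
qed

text \<open>The degree bounds make the source and the target of the Sylvester map both of dimension
  \<open>r + e\<close>, so that injectivity gives surjectivity.\<close>

lemma sylvester_onto:
  fixes W F p :: "'k::field poly"
  assumes W: "W \<in> polys_below (Suc r)" and F: "F \<in> polys_below (Suc e)"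
    and indep: "\<And>A B. A \<in> polys_below e \<Longrightarrow> B \<in> polys_below r \<Longrightarrow>
      A * W + B * F = 0 \<Longrightarrow> A = 0 \<and> B = 0"
    and p: "p \<in> polys_below (r + e)"
  obtains A B where "A \<in> polys_below e" "B \<in> polys_below r" "p = A * W + B * F"
proof -
  have parts: "poly_cutoff e q \<in> polys_below e" "poly_shift e q \<in> polys_below r"
    if "q \<in> polys_below (r + e)" for q :: "'k poly"
    using that by (auto simp: polys_below_def coeff_poly_cutoff coeff_poly_shift)
  have "polys_below (r + e) \<subseteq> sylvester_map e W F ` polys_below (r + e)"
  proof (rule linear_injective_onto[OF linear_sylvester_map])
    show "sylvester_map e W F ` polys_below (r + e) \<subseteq> polys_below (r + e)"
    proof safe
      fix q :: "'k poly" assume q: "q \<in> polys_below (r + e)"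
      have "poly_cutoff e q * W \<in> polys_below (r + e)"
        using polys_below_mult[OF parts(1)[OF q] W] by (simp add: add.commute)
      moreover have "poly_shift e q * F \<in> polys_below (r + e)"
        using polys_below_mult[OF parts(2)[OF q] F] .
      ultimately show "sylvester_map e W F q \<in> polys_below (r + e)"
        by (simp add: sylvester_map_def polys_below_def)
    qed
    fix q assume q: "q \<in> polys_below (r + e)" "sylvester_map e W F q = 0"
    then have z: "poly_cutoff e q = 0" "poly_shift e q = 0"
      using indep[OF parts[OF q(1)]] by (auto simp: sylvester_map_def)
    have "pcoeff q j = 0" for j
      using arg_cong[OF z(1), of "\<lambda>p. pcoeff p j"] arg_cong[OF z(2), of "\<lambda>p. pcoeff p (j - e)"]
      by (cases "j < e") (auto simp: coeff_poly_cutoff coeff_poly_shift)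
    then show "q = 0"
      by (simp add: poly_eq_iff)
  qed
  then obtain q where "q \<in> polys_below (r + e)" "p = sylvester_map e W F q"
    using p by blast
  then show ?thesis
    using that[OF parts] by (simp add: sylvester_map_def)
qed

text \<open>The cofactors fill only dimension \<open>m + n\<close>, one less than the target, whatever \<open>W\<close> and \<open>F\<close> are.\<close>

lemma sylvester_not_onto:
  fixes W F :: "'k::field poly"
  assumes "\<And>p. p \<in> polys_below (Suc (m + n)) \<Longrightarrow>
      \<exists>A\<in>polys_below m. \<exists>B\<in>polys_below n. p = A * W + B * F"
  shows False
proof -
  have "polys_below (Suc (m + n)) \<subseteq> sylvester_map m W F ` polys_below (m + n)"
  proof
    fix p :: "'k poly" assume "p \<in> polys_below (Suc (m + n))"
    then obtain A B where AB: "A \<in> polys_below m" "B \<in> polys_below n" "p = A * W + B * F"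
      using assms by blast
    have "A + Polynomial.monom 1 m * B \<in> polys_below (m + n)"
      using AB by (auto simp: polys_below_def coeff_monom_mult)
    then show "p \<in> sylvester_map m W F ` polys_below (m + n)"
      using sylvester_map_combine[OF AB(1), of W F B] AB(3) by (metis imageI)
  qed
  then show False
    using linear_not_onto_larger[OF linear_sylvester_map] by blast
qed

section \<open>Homogeneous parts and the order of a power series\<close>

text \<open>The homogeneous part \<open>\<Sum>\<^sub>j c\<^sub>j x\<^bsup>d-j\<^esup> y\<^sup>j\<close> of degree \<open>d\<close>, dehomogenised to \<open>\<Sum>\<^sub>j c\<^sub>j Y\<^sup>j\<close>: in this
  way products of forms are products in a univariate polynomial ring, which is a domain.\<close>
definition form :: "nat \<Rightarrow> 'k::field fps fps \<Rightarrow> 'k poly"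
  where "form d s = (\<Sum>j\<le>d. Polynomial.monom (fps_nth (fps_nth s j) (d - j)) j)"

lemma coeff_form: "pcoeff (form d s) j = (if j \<le> d then fps_nth (fps_nth s j) (d - j) else 0)"
  by (auto simp: form_def coeff_sum if_distrib sum.delta cong: if_cong)

lemma form_add [simp]: "form d (s + t) = form d s + form d t"
  by (simp add: poly_eq_iff coeff_form)

lemma form_diff [simp]: "form d (s - t) = form d s - form d t"
  by (simp add: poly_eq_iff coeff_form)

lemma form_zero [simp]: "form d 0 = 0"
  by (simp add: poly_eq_iff coeff_form)

lemma form_below: "form d s \<in> polys_below (Suc d)"
  by (auto simp: polys_below_def coeff_form)

lemma form_mult: "form d (s * t) = (\<Sum>i\<le>d. form i s * form (d - i) t)"
proof (rule poly_eqI)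
  fix j
  \<comment> \<open>The contribution of \<open>x\<^bsup>i-a\<^esup> y\<^sup>a\<close> in \<open>s\<close> and of \<open>x\<^bsup>d-i-(j-a)\<^esup> y\<^bsup>j-a\<^esup>\<close> in \<open>t\<close>, for fixed \<open>j\<close>.\<close>
  let ?g = "\<lambda>a i. if a \<le> i \<and> j - a \<le> d - i
    then fps_nth (fps_nth s a) (i - a) * fps_nth (fps_nth t (j - a)) (d - i - (j - a)) else 0"
  have R: "pcoeff (\<Sum>i\<le>d. form i s * form (d - i) t) j = (\<Sum>a\<le>j. \<Sum>i\<le>d. ?g a i)"
    by (subst sum.swap) (auto simp: coeff_sum coeff_mult coeff_form intro!: sum.cong)
  show "pcoeff (form d (s * t)) j = pcoeff (\<Sum>i\<le>d. form i s * form (d - i) t) j"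
  proof (cases "j \<le> d")
    case False
    then have "?g a i = 0" if "a \<le> j" "i \<le> d" for a i
      using that by auto
    then show ?thesis
      using False unfolding R by (simp add: coeff_form)
  next
    case True
    have "(\<Sum>i\<le>d. ?g a i) = fps_nth (fps_nth s a * fps_nth t (j - a)) (d - j)" if a: "a \<le> j" for a
    proof -
      have "(\<Sum>i\<le>d. ?g a i) = (\<Sum>i\<in>{a..a + (d - j)}. ?g a i)"
        using True a by (intro sum.mono_neutral_right) auto
      also have "\<dots> = (\<Sum>b\<in>{0..d - j}. fps_nth (fps_nth s a) b * fps_nth (fps_nth t (j - a)) (d - j - b))"
        using True a
        by (intro sum.reindex_bij_witness[of _ "\<lambda>b. a + b" "\<lambda>i. i - a"]) (auto simp: algebra_simps)
      finally show ?thesis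
        by (simp add: fps_mult_nth)
    qed
    then show ?thesis
      using True unfolding R by (simp add: coeff_form fps_mult_nth fps_sum_nth atMost_atLeast0)
  qed
qed

definition series_of_form :: "nat \<Rightarrow> 'k::field poly \<Rightarrow> 'k fps fps"
  where "series_of_form d p = Abs_fps (\<lambda>j. Abs_fps (\<lambda>i. if i + j = d then pcoeff p j else 0))"

lemma form_series_of_form:
  assumes "p \<in> polys_below (Suc d)"
  shows "form n (series_of_form d p) = (if n = d then p else 0)"
  using assms by (auto simp: poly_eq_iff coeff_form series_of_form_def polys_below_def not_le Suc_le_eq)

definition order_ge :: "nat \<Rightarrow> 'k::field fps fps set"
  where "order_ge d = {s. \<forall>i<d. form i s = 0}"

lemma order_ge_0 [simp]: "order_ge 0 = UNIV" 
  by (auto simp: order_ge_def)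

lemma order_ge_antimono: "c \<le> d \<Longrightarrow> order_ge d \<subseteq> order_ge c"
  by (auto simp: order_ge_def)

lemma order_ge_add: "s \<in> order_ge d \<Longrightarrow> t \<in> order_ge d \<Longrightarrow> s + t \<in> order_ge d"
  by (auto simp: order_ge_def)

lemma order_ge_diff: "s \<in> order_ge d \<Longrightarrow> t \<in> order_ge d \<Longrightarrow> s - t \<in> order_ge d"
  by (auto simp: order_ge_def)

lemma order_ge_Suc_iff: "s \<in> order_ge (Suc d) \<longleftrightarrow> s \<in> order_ge d \<and> form d s = 0"
  by (auto simp: order_ge_def less_Suc_eq)

lemma order_ge_mult:
  assumes "s \<in> order_ge c" "t \<in> order_ge d"
  shows "s * t \<in> order_ge (c + d)"
proof -
  have "form i s * form (n - i) t = 0" if "n < c + d" "i \<le> n" for n i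
    using assms that by (cases "i < c") (auto simp: order_ge_def)
  then show ?thesis
    by (auto simp: order_ge_def form_mult intro!: sum.neutral)
qed

lemma form_mult_lowest:
  assumes "s \<in> order_ge c" "t \<in> order_ge d"
  shows "form (c + d) (s * t) = form c s * form d t"
proof -
  have "form (c + d) (s * t) = (\<Sum>i\<in>{c}. form i s * form (c + d - i) t)"
    unfolding form_mult
  proof (rule sum.mono_neutral_right)
    show "\<forall>i\<in>{..c + d} - {c}. form i s * form (c + d - i) t = 0"
    proof
      fix i assume "i \<in> {..c + d} - {c}"
      then show "form i s * form (c + d - i) t = 0"
        using assms by (cases "i < c") (auto simp: order_ge_def)
    qed
  qed auto
  then show ?thesis by simp
qed

lemma series_of_form_order_ge: "p \<in> polys_below (Suc d) \<Longrightarrow> series_of_form d p \<in> order_ge d"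
  by (simp add: order_ge_def form_series_of_form)

text \<open>The lowest form of \<open>f b\<close> is the product of the lowest forms, which does not vanish
  because polynomials over a field form a domain; so the order of \<open>b\<close> is read off from that
  of \<open>f b\<close>.\<close>

lemma cofactor_order:
  assumes f: "f \<in> order_ge e" "f \<notin> order_ge (Suc e)"
    and fb: "f * b \<in> order_ge (e + n)"
  shows "b \<in> order_ge n"
  using fb
proof (induction n)
  case (Suc n)
  have "b \<in> order_ge n"
    using Suc order_ge_antimono[of "e + n" "e + Suc n"] by auto
  moreover have "form e f * form n b = 0"
    using Suc.prems form_mult_lowest[OF f(1) \<open>b \<in> order_ge n\<close>] by (simp add: order_ge_def)
  ultimately show ?case
    using f by (simp add: order_ge_Suc_iff)
qed simp

text \<open>Every monomial of positive degree is divisible by \<open>x\<close> or by \<open>y\<close>; the monomials free of \<open>y\<close>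
  form the constant term in \<open>k[[x]][[y]]\<close>.\<close>

lemma order_ge_Suc_decompose:
  assumes "s \<in> order_ge (Suc d)"
  obtains t u where "t \<in> order_ge d" "u \<in> order_ge d" "s = var_x * t + var_y * u"
proof
  let ?t = "fps_const (fps_shift 1 (fps_nth s 0))" and ?u = "fps_shift 1 s"
  have z: "fps_nth (fps_nth s j) i = 0" if "i + j \<le> d" for i j
  proof -
    have "form (i + j) s = 0" using assms that by (simp add: order_ge_def)
    then show ?thesis using coeff_form[of "i + j" s j] by simp
  qed
  show "?t \<in> order_ge d" "?u \<in> order_ge d"
    using z by (auto simp: order_ge_def poly_eq_iff coeff_form)
  have "fps_X * fps_shift 1 (fps_nth s 0) = fps_nth s 0"
    using z[of 0 0] by (auto simp: fps_eq_iff)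
  then show "s = var_x * ?t + var_y * ?u"
    by (auto simp: fps_eq_iff[of s] var_x_def var_y_def)
qed

lemma var_x_order: "var_x \<in> order_ge 1" and var_y_order: "var_y \<in> order_ge 1"
  by (auto simp: order_ge_def poly_eq_iff coeff_form var_x_def var_y_def)

section \<open>Ideals generated by two series with coprime initial forms\<close>

text \<open>The assumption \<open>regular\<close> says, in terms of representatives in \<open>k[[x, y]]\<close>, that
  multiplication by the initial form of the class of \<open>w\<close> is injective on the graded ring of
  \<open>k[[x, y]]/(f)\<close>.\<close>

locale regular_initial_form =
  fixes f w :: "'k::field fps fps" and e r :: nat
  assumes pos: "0 < e" "0 < r"
    and f_order: "f \<in> order_ge e" "f \<notin> order_ge (Suc e)"
    and w_order: "w \<in> order_ge r" "w \<notin> order_ge (Suc r)"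
    and regular: "a \<in> order_ge i \<Longrightarrow> w * a + f * b \<in> order_ge (Suc (r + i)) \<Longrightarrow>
      \<exists>c. a + f * c \<in> order_ge (Suc i)"
begin

lemma combination_of_forms:
  assumes A: "A \<in> polys_below e" and B: "B \<in> polys_below r"
  defines "t \<equiv> w * series_of_form (e - 1) A + f * series_of_form (r - 1) B"
  shows "t \<in> order_ge (r + e - 1)" and "form (r + e - 1) t = A * form r w + B * form e f"
proof -
  let ?a = "series_of_form (e - 1) A" and ?b = "series_of_form (r - 1) B"
  have a: "?a \<in> order_ge (e - 1)" and b: "?b \<in> order_ge (r - 1)"
    using A B pos by (auto intro: series_of_form_order_ge)
  have d: "r + (e - 1) = r + e - 1" "e + (r - 1) = r + e - 1"
    using pos by auto
  show "t \<in> order_ge (r + e - 1)"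
    using order_ge_mult[OF w_order(1) a] order_ge_mult[OF f_order(1) b]
    unfolding t_def d by (rule order_ge_add)
  have "form (e - 1) ?a = A" "form (r - 1) ?b = B"
    using A B pos by (simp_all add: form_series_of_form)
  then show "form (r + e - 1) t = A * form r w + B * form e f"
    using form_mult_lowest[OF w_order(1) a] form_mult_lowest[OF f_order(1) b]
    unfolding t_def form_add d by (simp add: mult.commute)
qed

text \<open>For the homogeneous series \<open>a\<close>, \<open>b\<close> with forms \<open>A\<close>, \<open>B\<close>, the relation pushes \<open>w a + f b\<close> beyond
  order \<open>r + e - 1\<close>, and regularity makes \<open>a\<close> congruent modulo \<open>f\<close> to a series of order at least \<open>e\<close>.
  Since \<open>f\<close> itself has order \<open>e\<close>, it cannot affect degree \<open>e - 1\<close>, and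
  hence \<open>a = 0\<close>.\<close>

lemma initial_forms_coprime:
  assumes A: "A \<in> polys_below e" and B: "B \<in> polys_below r"
    and zero: "A * form r w + B * form e f = 0"
  shows "A = 0 \<and> B = 0"
proof -
  let ?a = "series_of_form (e - 1) A"
  have "w * ?a + f * series_of_form (r - 1) B \<in> order_ge (Suc (r + e - 1))"
    using combination_of_forms[OF A B] zero by (simp add: order_ge_Suc_iff)
  moreover have "Suc (r + e - 1) = Suc (r + (e - 1))"
    using pos by simp
  moreover have "?a \<in> order_ge (e - 1)"
    using A pos by (simp add: series_of_form_order_ge)
  ultimately obtain c where "?a + f * c \<in> order_ge (Suc (e - 1))"
    using regular by metis
  moreover have "f * c \<in> order_ge (Suc (e - 1))"
    using order_ge_mult[OF f_order(1), of c 0] pos by simp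
  ultimately have "?a + f * c - f * c \<in> order_ge (Suc (e - 1))"
    by (rule order_ge_diff)
  then have "form (e - 1) ?a = 0"
    by (simp add: order_ge_def)
  then have "A = 0"
    using A pos by (simp add: form_series_of_form)
  then show ?thesis
    using zero f_order by (simp add: order_ge_Suc_iff)
qed

text \<open>This is the ideal \<open>(w, f)\<close>.\<close>
definition combinations :: "'k fps fps set"
  where "combinations = {w * a + f * b | a b. True}"

lemma combinations_add: "s \<in> combinations \<Longrightarrow> t \<in> combinations \<Longrightarrow> s + t \<in> combinations"
proof -
  assume "s \<in> combinations" "t \<in> combinations"
  then obtain a b a' b' where "s = w * a + f * b" "t = w * a' + f * b'"
    unfolding combinations_def by blast
  then have "s + t = w * (a + a') + f * (b + b')"
    by (simp add: algebra_simps)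
  then show ?thesis
    unfolding combinations_def by blast
qed

lemma combinations_mult: "t \<in> combinations \<Longrightarrow> s * t \<in> combinations"
proof -
  assume "t \<in> combinations"
  then obtain a b where "t = w * a + f * b"
    unfolding combinations_def by blast
  then have "s * t = w * (s * a) + f * (s * b)"
    by (simp add: algebra_simps)
  then show ?thesis
    unfolding combinations_def by blast
qed

text \<open>In degree \<open>r + e - 1\<close> this is surjectivity of the Sylvester map of the initial forms; in
  higher degrees it follows because every series of order at least \<open>d + 1\<close> is \<open>x t + y u\<close> with
  \<open>t\<close> and \<open>u\<close> of order at least \<open>d\<close>, and \<open>(w, f)\<close> is an ideal.\<close>

lemma combination_modulo_next_order:
  assumes "s \<in> order_ge (r + e - 1 + n)"
  shows "\<exists>t\<in>combinations. s - t \<in> order_ge (Suc (r + e - 1 + n))"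
  using assms
proof (induction n arbitrary: s)
  case 0
  have "form (r + e - 1) s \<in> polys_below (r + e)"
    using form_below[of "r + e - 1" s] pos by simp
  then obtain A B where AB: "A \<in> polys_below e" "B \<in> polys_below r"
    "form (r + e - 1) s = A * form r w + B * form e f"
    using sylvester_onto[OF form_below form_below initial_forms_coprime] by blast
  let ?t = "w * series_of_form (e - 1) A + f * series_of_form (r - 1) B"
  have "s - ?t \<in> order_ge (Suc (r + e - 1))"
    using 0 AB(3) combination_of_forms[OF AB(1,2)]
    by (simp add: order_ge_Suc_iff order_ge_diff del: form_add)
  moreover have "?t \<in> combinations"
    unfolding combinations_def by blast
  ultimately show ?case
    by auto
next
  case (Suc n)
  then obtain t u where tu: "t \<in> order_ge (r + e - 1 + n)" "u \<in> order_ge (r + e - 1 + n)"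
    "s = var_x * t + var_y * u"
    using order_ge_Suc_decompose[of s "r + e - 1 + n"] by auto
  obtain t' u' where t': "t' \<in> combinations" "t - t' \<in> order_ge (Suc (r + e - 1 + n))"
    and u': "u' \<in> combinations" "u - u' \<in> order_ge (Suc (r + e - 1 + n))"
    using Suc.IH tu by meson
  have "var_x * (t - t') + var_y * (u - u') \<in> order_ge (Suc (r + e - 1 + Suc n))"
    using order_ge_mult[OF var_x_order t'(2)] order_ge_mult[OF var_y_order u'(2)]
    by (simp add: order_ge_add)
  moreover have "s - (var_x * t' + var_y * u') = var_x * (t - t') + var_y * (u - u')"
    by (simp add: tu algebra_simps)
  moreover have "var_x * t' + var_y * u' \<in> combinations"
    by (intro combinations_add combinations_mult t' u')
  ultimately show ?case
    by metis
qed

text \<open>Successive corrections push the error term beyond order \<open>g\<close> after finitely many steps,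
  where it lies in the ideal by hypothesis. The hypothesis thus takes the place of
  Nakayama's lemma.\<close>

lemma combinations_contain_order_ge:
  assumes g: "order_ge g \<subseteq> combinations"
  shows "order_ge (r + e - 1) \<subseteq> combinations"
proof
  fix s :: "'k fps fps" assume s: "s \<in> order_ge (r + e - 1)"
  have "\<exists>t\<in>combinations. s - t \<in> order_ge (r + e - 1 + n)" for n
  proof (induction n)
    case 0
    have "w * 0 + f * 0 \<in> combinations"
      unfolding combinations_def by blast
    then show ?case
      using s by (intro bexI[of _ 0]) auto
  next
    case (Suc n)
    then obtain t where t: "t \<in> combinations" "s - t \<in> order_ge (r + e - 1 + n)"
      by blast
    obtain u where u: "u \<in> combinations" "s - t - u \<in> order_ge (Suc (r + e - 1 + n))"
      using combination_modulo_next_order[OF t(2)] by blast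
    then show ?case
      using combinations_add[OF t(1) u(1)] by (intro bexI[of _ "t + u"]) (auto simp: algebra_simps)
  qed
  then obtain t where t: "t \<in> combinations" "s - t \<in> order_ge (r + e - 1 + g)"
    by blast
  then have "s - t \<in> combinations"
    using g order_ge_antimono[of g "r + e - 1 + g"] by auto
  then show "s \<in> combinations"
    using combinations_add[OF t(1)] by force
qed

text \<open>As long as \<open>w a\<close> lies modulo \<open>f\<close> in higher order than \<open>a\<close> accounts for, regularity allows
  replacing \<open>a\<close> by a congruent series of larger order.\<close>

lemma raise_cofactor_order:
  assumes "w * a + f * b \<in> order_ge (r + n)"
  shows "\<exists>a' b'. a' \<in> order_ge n \<and> w * a' + f * b' = w * a + f * b"
proof -
  have "\<exists>a' b'. a' \<in> order_ge i \<and> w * a' + f * b' = w * a + f * b" if "i \<le> n" for i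
    using that
  proof (induction i)
    case 0
    then show ?case by auto
  next
    case (Suc i)
    then obtain a' b' where ab: "a' \<in> order_ge i" "w * a' + f * b' = w * a + f * b"
      by auto
    have "w * a' + f * b' \<in> order_ge (Suc (r + i))"
      using assms Suc.prems order_ge_antimono[of "Suc (r + i)" "r + n"] unfolding ab(2) by auto
    then obtain c where c: "a' + f * c \<in> order_ge (Suc i)"
      using regular[OF ab(1)] by blast
    have "w * (a' + f * c) + f * (b' - w * c) = w * a + f * b"
      unfolding ab(2)[symmetric] by (simp add: algebra_simps)
    then show ?case
      using c by blast
  qed
  then show ?thesis by blast
qed

text \<open>Truncated subtraction covers the case \<open>d < c\<close> too: then the bound on \<open>a\<close> is void, the
  cofactor space is zero, and the form of degree \<open>d\<close> vanishes.\<close>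

lemma lowest_form_of_multiple:
  assumes s: "s \<in> order_ge c" and a: "a \<in> order_ge (d - c)"
  shows "\<exists>A\<in>polys_below (Suc d - c). form d (s * a) = A * form c s"
proof (cases "c \<le> d")
  case True
  then show ?thesis
    using form_mult_lowest[OF s a] form_below[of "d - c" a]
    by (intro bexI[of _ "form (d - c) a"]) (auto simp: Suc_diff_le mult.commute)
next
  case False
  then have "form d (s * a) = 0"
    using order_ge_mult[OF s, of a 0] by (simp add: order_ge_def)
  then show ?thesis
    by (intro bexI[of _ 0]) (auto simp: polys_below_def)
qed

text \<open>Degree \<open>r + e - 2\<close> suffices. There the cofactors of a form \<open>w a + f b\<close> may be taken of
  orders at least \<open>e - 2\<close> and \<open>r - 2\<close>, so all \<open>r + e - 1\<close> monomials of this degree would come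
  from a pair of spaces of dimensions \<open>e - 1\<close> and \<open>r - 1\<close>.\<close>

lemma not_all_combinations:
  assumes d: "Suc d < r + e"
  shows "\<not> order_ge d \<subseteq> combinations"
proof
  assume "order_ge d \<subseteq> combinations"
  define D where "D = r + e - 2"
  have D: "r + e = Suc (Suc D)"
    using pos by (simp add: D_def)
  have C: "order_ge D \<subseteq> combinations"
    using \<open>order_ge d \<subseteq> combinations\<close> order_ge_antimono[of d D] d D by auto
  have "\<exists>A\<in>polys_below (e - 1). \<exists>B\<in>polys_below (r - 1). p = A * form r w + B * form e f"
    if p: "p \<in> polys_below (Suc (e - 1 + (r - 1)))" for p
  proof -
    have "Suc (e - 1 + (r - 1)) = Suc D"
      using D pos by simp
    then have p': "p \<in> polys_below (Suc D)"
      using p by (simp only:)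
    let ?h = "series_of_form D p"
    have h: "?h \<in> order_ge D" "form D ?h = p"
      using p' by (simp_all add: form_series_of_form series_of_form_order_ge)
    then obtain a0 b0 where ab0: "?h = w * a0 + f * b0"
      using C unfolding combinations_def by blast
    have "\<exists>a b. a \<in> order_ge (D - r) \<and> ?h = w * a + f * b"
    proof (cases "r \<le> D")
      case True
      then have "w * a0 + f * b0 \<in> order_ge (r + (D - r))"
        using h(1) ab0 by simp
      from raise_cofactor_order[OF this] show ?thesis
        unfolding ab0 by metis
    qed (use ab0 in auto)
    then obtain a b where a: "a \<in> order_ge (D - r)" and hab: "?h = w * a + f * b"
      by blast
    have "w * a \<in> order_ge D"
      using order_ge_mult[OF w_order(1) a]
      by (rule rev_subsetD) (rule order_ge_antimono, simp)
    then have fb: "f * b \<in> order_ge D"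
      using order_ge_diff[OF h(1)] hab by (metis add_diff_cancel_left')
    have b: "b \<in> order_ge (D - e)"
    proof (cases "e \<le> D")
      case True
      then show ?thesis
        using cofactor_order[OF f_order, of b "D - e"] fb by simp
    qed simp
    have "Suc D - r = e - 1" "Suc D - e = r - 1"
      using D by simp_all
    then show ?thesis
      using lowest_form_of_multiple[OF w_order(1) a] lowest_form_of_multiple[OF f_order(1) b]
        h(2) unfolding hab form_add by metis
  qed
  then show False
    by (rule sylvester_not_onto)
qed

end

section \<open>Powers of the maximal ideal of \<open>k[[x, y]]\<close>\<close>

lemma kxy_simps [simp]:
  "carrier kxy = UNIV" "s \<otimes>\<^bsub>kxy\<^esub> t = s * t" "s \<oplus>\<^bsub>kxy\<^esub> t = s + t"
  "\<zero>\<^bsub>kxy\<^esub> = 0" "\<one>\<^bsub>kxy\<^esub> = 1"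
  by (simp_all add: kxy_def ring_of_type_algebra_def)

lemma cring_kxy: "cring kxy"
  unfolding kxy_def by (rule cring_from_type_algebra)

interpretation kxy: cring kxy
  by (rule cring_kxy)

lemma uminus_kxy [simp]: "\<ominus>\<^bsub>kxy\<^esub> s = - s"
  using kxy.minus_equality[of "- s" s] by simp

lemma ideal_kxyI:
  assumes "0 \<in> I" "\<And>s t. s \<in> I \<Longrightarrow> t \<in> I \<Longrightarrow> s + t \<in> I" "\<And>s t. t \<in> I \<Longrightarrow> s * t \<in> I"
  shows "ideal I kxy"
proof (rule idealI)
  show "subgroup I (add_monoid kxy)"
  proof (rule kxy.add.subgroupI)
    fix s assume s: "s \<in> I"
    show "\<ominus>\<^bsub>kxy\<^esub> s \<in> I"
      using assms(3)[OF s, of "- 1"] by simp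
  qed (use assms in auto)
qed (use assms(3) kxy.ring_axioms in \<open>auto simp: mult.commute\<close>)

lemma principal_ideal_kxy: "genideal kxy {f} = range ((*) f)"
  using kxy.cgenideal_eq_genideal[of f] by (auto simp: cgenideal_def mult.commute)

lemma ideal_order_ge: "ideal (order_ge d :: 'k::field fps fps set) kxy"
proof (rule ideal_kxyI)
  show "s * t \<in> order_ge d" if "t \<in> order_ge d" for s t :: "'k fps fps"
    using order_ge_mult[of s 0 t d] that by simp
qed (auto simp: order_ge_add, auto simp: order_ge_def)

lemma kxy_max_eq: "kxy_max = (order_ge 1 :: 'k::field fps fps set)"
proof
  show "kxy_max \<subseteq> (order_ge 1 :: 'k fps fps set)"
    unfolding kxy_max_def
    by (rule kxy.genideal_minimal) (auto simp: ideal_order_ge var_x_order[simplified] var_y_order[simplified])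
  interpret ideal "kxy_max :: 'k fps fps set" kxy
    unfolding kxy_max_def by (rule kxy.genideal_ideal) simp
  have xy: "var_x \<in> (kxy_max :: 'k fps fps set)" "var_y \<in> (kxy_max :: 'k fps fps set)"
    unfolding kxy_max_def using kxy.genideal_self[of "{var_x, var_y}"] by auto
  show "(order_ge 1 :: 'k fps fps set) \<subseteq> kxy_max"
  proof
    fix s :: "'k fps fps" assume "s \<in> order_ge 1"
    then obtain t u where "s = var_x * t + var_y * u"
      using order_ge_Suc_decompose[of s 0] by auto
    then show "s \<in> kxy_max"
      using a_closed[OF I_r_closed[OF xy(1), of t] I_r_closed[OF xy(2), of u]] by simp
  qed
qed

text \<open>Splitting off one variable from every monomial writes a series of order at least \<open>d + 1\<close> as a
  sum of two products from the next power. The order with respect to the maximal ideal is thereby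
  read off from the coefficients.\<close>

lemma kxy_max_pow: "ideal_pow kxy kxy_max d = (order_ge d :: 'k::field fps fps set)"
proof (induction d)
  case 0
  then show ?case by (simp add: ideals_set_def)
next
  case (Suc d)
  have "ideal_prod kxy (order_ge d) (order_ge 1) = (order_ge (Suc d) :: 'k fps fps set)"
  proof
    show "ideal_prod kxy (order_ge d) (order_ge 1) \<subseteq> (order_ge (Suc d) :: 'k fps fps set)"
    proof
      fix s :: "'k fps fps" assume "s \<in> ideal_prod kxy (order_ge d) (order_ge 1)"
      then show "s \<in> order_ge (Suc d)"
      proof induction
        case (prod i j)
        then show ?case using order_ge_mult[of i d j 1] by simp
      qed (simp add: order_ge_add)
    qed
    show "(order_ge (Suc d) :: 'k fps fps set) \<subseteq> ideal_prod kxy (order_ge d) (order_ge 1)"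
    proof
      fix s :: "'k fps fps" assume "s \<in> order_ge (Suc d)"
      then obtain t u where tu: "t \<in> order_ge d" "u \<in> order_ge d" "s = var_x * t + var_y * u"
        using order_ge_Suc_decompose by blast
      then have "s = (t \<otimes>\<^bsub>kxy\<^esub> var_x) \<oplus>\<^bsub>kxy\<^esub> (u \<otimes>\<^bsub>kxy\<^esub> var_y)"
        by (simp add: mult.commute)
      then show "s \<in> ideal_prod kxy (order_ge d) (order_ge 1)"
        using ideal_prod.sum[OF ideal_prod.prod ideal_prod.prod] tu(1,2) var_x_order var_y_order
        by metis
    qed
  qed
  then show ?case
    using Suc by (simp add: kxy_max_eq ideals_set_def)
qed

section \<open>Ideals of quotient rings\<close>

lemma (in cring) quotient_genideal:
  assumes J: "ideal J R" and A: "A \<subseteq> carrier R"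
  shows "genideal (R Quot J) ((+>) J ` A) = (+>) J ` genideal R A"
proof
  interpret J: ideal J R by fact
  interpret h: ring_hom_ring R "R Quot J" "(+>) J" by (rule J.rcos_ring_hom_ring)
  have I: "ideal (genideal R A) R"
    using A by (rule genideal_ideal)
  have hA: "(+>) J ` A \<subseteq> carrier (R Quot J)"
    using A by auto
  show "genideal (R Quot J) ((+>) J ` A) \<subseteq> (+>) J ` genideal R A"
    using genideal_self[OF A] ring_ideal_imp_quot_ideal[OF J I]
    by (intro h.S.genideal_minimal) auto
  have "A \<subseteq> {a \<in> carrier R. J +> a \<in> genideal (R Quot J) ((+>) J ` A)}"
    using A h.S.genideal_self[OF hA] by auto
  then have "genideal R A \<subseteq> {a \<in> carrier R. J +> a \<in> genideal (R Quot J) ((+>) J ` A)}"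
    by (rule genideal_minimal[OF h.ideal_vimage[OF h.S.genideal_ideal[OF hA]]])
  then show "(+>) J ` genideal R A \<subseteq> genideal (R Quot J) ((+>) J ` A)"
    by blast
qed

lemma (in ring_hom_ring) ideal_prod_image:
  assumes I: "ideal I R" and J: "ideal J R"
  shows "ideal_prod S (h ` I) (h ` J) = h ` ideal_prod R I J"
proof
  have IJ: "I \<subseteq> carrier R" "J \<subseteq> carrier R" "ideal_prod R I J \<subseteq> carrier R"
    using I J R.ideal_prod_in_carrier by (auto dest: ideal.Icarr)
  show "ideal_prod S (h ` I) (h ` J) \<subseteq> h ` ideal_prod R I J"
  proof
    fix s assume "s \<in> ideal_prod S (h ` I) (h ` J)"
    then show "s \<in> h ` ideal_prod R I J"
    proof induction
      case (prod i j)
      then obtain a b where "a \<in> I" "b \<in> J" "i = h a" "j = h b"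
        by blast
      then show ?case
        using IJ by (intro image_eqI[of _ _ "a \<otimes>\<^bsub>R\<^esub> b"]) (auto intro: ideal_prod.prod simp: subsetD)
    next
      case (sum s1 s2)
      then obtain a b where "a \<in> ideal_prod R I J" "b \<in> ideal_prod R I J" "s1 = h a" "s2 = h b"
        by blast
      then show ?case
        using IJ by (intro image_eqI[of _ _ "a \<oplus>\<^bsub>R\<^esub> b"]) (auto intro: ideal_prod.sum simp: subsetD)
    qed
  qed
  show "h ` ideal_prod R I J \<subseteq> ideal_prod S (h ` I) (h ` J)"
  proof safe
    fix s assume "s \<in> ideal_prod R I J"
    then show "h s \<in> ideal_prod S (h ` I) (h ` J)"
    proof induction
      case (prod i j)
      then show ?case
        using ideal_prod.prod[of "h i" "h ` I" "h j" "h ` J" S] prod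
          hom_mult[of i j] subsetD[OF IJ(1) prod(1)] subsetD[OF IJ(2) prod(2)]
        by simp
    next
      case (sum s1 s2)
      then show ?case
        using ideal_prod.sum[OF sum.IH] 
          hom_add[of s1 s2] subsetD[OF IJ(3) sum.hyps(1)] subsetD[OF IJ(3) sum.hyps(2)]
        by simp
    qed
  qed
qed

lemma (in cring) quotient_ideal_pow:
  assumes J: "ideal J R" and I: "ideal I R"
  shows "ideal_pow (R Quot J) ((+>) J ` I) n = (+>) J ` ideal_pow R I n"
proof (induction n)
  case 0
  show ?case
    by (simp add: ideals_set_def FactRing_def A_RCOSETS_def' UNION_singleton_eq_range)
next
  case (Suc n)
  interpret J: ideal J R by fact
  interpret h: ring_hom_ring R "R Quot J" "(+>) J" by (rule J.rcos_ring_hom_ring)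
  show ?case
    using h.ideal_prod_image[OF ideal_pow_ideal[OF I, of n] I] Suc
    by (simp add: ideals_set_def)
qed

section \<open>Cancelling an element with regular initial form\<close>

lemma (in cring) ideal_pow_antimono:
  assumes "ideal I R" "m \<le> n"
  shows "ideal_pow R I n \<subseteq> ideal_pow R I m"
proof -
  have "ideal_pow R I (Suc k) \<subseteq> ideal_pow R I k" for k
    using ideal_prod_inter[OF ideal_pow_ideal[OF assms(1), of k] assms(1)]
    by (simp add: ideals_set_def)
  then show ?thesis
    using assms(2) by (rule lift_Suc_antimono_le)
qed

lemma (in cring) has_order_unique:
  assumes I: "ideal I R" and "has_order R I z m" "has_order R I z n"
  shows "m = n"
  using assms(2,3) ideal_pow_antimono[OF I, of "Suc m" n] ideal_pow_antimono[OF I, of "Suc n" m]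
  by (cases m n rule: linorder_cases) (auto simp: has_order_def)

text \<open>Regularity is tested on the homogeneous element of degree \<open>i\<close> given by the class of \<open>a\<close>:
  its product with the initial form of \<open>z\<close> is the class of \<open>z a\<close> in degree \<open>r + i\<close>, which vanishes.\<close>

lemma (in cring) regular_initial_form_cancel:
  assumes I: "ideal I R" and z: "has_order R I z r"
    and regular: "regular_element (assoc_graded R I) (initial_form R I z)"
    and a: "a \<in> ideal_pow R I i" and za: "z \<otimes> a \<in> ideal_pow R I (Suc (r + i))"
  shows "a \<in> ideal_pow R I (Suc i)"
proof -
  let ?P = "ideal_pow R I"
  let ?Z = "\<lambda>n. \<zero>\<^bsub>graded_quot R I n\<^esub>"
  have P: "ideal (?P n) R" for n
    by (rule ideal_pow_ideal[OF I])
  have zero_P: "\<zero> \<in> ?P n" for n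
    using P[of n] by (simp add: additive_subgroup.zero_closed ideal.axioms(1))
  have coset_zero: "?P (Suc n) +> b = ?Z n" if "b \<in> ?P (Suc n)" for b n
    using abelian_subgroup.a_rcos_const[OF abelian_subgroupI3 that] P[of "Suc n"] is_abelian_group
    by (auto simp: FactRing_def ideal_def)
  \<comment> \<open>Representatives of the homogeneous components of the two factors.\<close>
  define x where "x n = (if has_order R I z n then z else \<zero>)" for n
  define y where "y n = (if n = i then a else \<zero>)" for n
  have x: "x n \<in> ?P n" and y: "y n \<in> ?P n" for n
    using a zero_P by (auto simp: x_def y_def has_order_def)
  have init: "initial_form R I z n = ?P (Suc n) +> x n" for n
    using coset_zero[OF zero_P] by (simp add: initial_form_def x_def)
  let ?b = "\<lambda>n. ?P (Suc n) +> y n"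
  have xy: "x k \<otimes> y (n - k) \<in> ?P (Suc n)" if "k \<le> n" for k n
  proof (cases "has_order R I z k \<and> n - k = i")
    case True
    then have "k = r" "n = r + i"
      using has_order_unique[OF I z] that by auto
    then show ?thesis
      using za z by (simp add: x_def y_def)
  next
    case False
    then have "x k \<otimes> y (n - k) = \<zero>"
      using ideal.Icarr[OF P a] ideal.Icarr[OF P x, of k] by (auto simp: x_def y_def split: if_splits)
    then show ?thesis
      by (metis zero_P)
  qed
  have "?b n = ?Z n" if "n \<noteq> i" for n
    using that coset_zero[OF zero_P] by (simp add: y_def)
  then have "{n. ?b n \<noteq> ?Z n} \<subseteq> {i}"
    by blast
  then have "finite {n. ?b n \<noteq> ?Z n}"
    by (rule finite_subset) simp
  moreover have "?b n \<in> graded_piece R I n" for n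
    unfolding graded_piece_def using y by (rule imageI)
  ultimately have "?b \<in> carrier (assoc_graded R I)"
    by (simp add: assoc_graded_def del: nat_pow_Suc)
  moreover have "initial_form R I z \<otimes>\<^bsub>assoc_graded R I\<^esub> ?b = \<zero>\<^bsub>assoc_graded R I\<^esub>"
  proof -
    have "rcoset_mult R (?P (Suc n)) (initial_form R I z k) (?b (n - k)) = ?Z n" if "k \<le> n" for k n
      using graded_mult_coset[OF I x[of k] y[of "n - k"]] coset_zero[OF xy[OF that]] that
      by (simp add: init del: nat_pow_Suc)
    moreover have "comm_monoid (add_monoid (graded_quot R I n))" for n
      by (intro abelian_monoid.a_comm_monoid abelian_group.axioms(1) ring.is_abelian_group
          ideal.quotient_is_ring P)
    ultimately have "(\<Oplus>\<^bsub>graded_quot R I n\<^esub>k\<in>{..n}.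
        rcoset_mult R (?P (Suc n)) (initial_form R I z k) (?b (n - k))) = ?Z n" for n
      unfolding finsum_def
      by (subst comm_monoid.finprod_one_eqI) auto
    then show ?thesis
      by (simp add: assoc_graded_def)
  qed
  ultimately have "?b = \<zero>\<^bsub>assoc_graded R I\<^esub>"
    using regular by (simp add: regular_element_def)
  then have "?P (Suc i) +> a = ?P (Suc i)"
    by (auto simp: assoc_graded_def FactRing_def y_def dest: fun_cong[of _ _ i])
  then show ?thesis
    using ideal.rcos_const_imp_mem[OF P ideal.Icarr[OF P a]] by metis
qed

section \<open>Plane curve rings\<close>

abbreviation residue :: "'k::field fps fps \<Rightarrow> 'k fps fps \<Rightarrow> 'k fps fps set"
  where "residue f \<equiv> (+>\<^bsub>kxy\<^esub>) (genideal kxy {f})"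

lemma principal_ideal: "ideal (genideal kxy {f}) kxy"
  by (rule kxy.genideal_ideal) simp

lemma residue_eq_iff: "residue f s = residue f t \<longleftrightarrow> (\<exists>b. s = t + f * b)"
proof -
  have "residue f s = residue f t \<longleftrightarrow> s - t \<in> range ((*) f)"
    using kxy.quotient_eq_iff_same_a_r_cos[OF principal_ideal[of f], of s t]
    by (simp add: a_minus_def principal_ideal_kxy)
  also have "\<dots> \<longleftrightarrow> (\<exists>b. s = t + f * b)"
    by (auto simp: algebra_simps)
  finally show ?thesis .
qed

lemma curve_max_pow: "ideal_pow (curve_ring f) (curve_max f) n = residue f ` order_ge n"
  and curve_max_eq: "curve_max f = residue f ` order_ge 1"
proof -
  have "curve_max f = residue f ` kxy_max"
    using kxy.quotient_genideal[OF principal_ideal, of "{var_x, var_y}" f]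
    by (simp add: curve_max_def curve_ring_def kxy_max_def)
  then show eq: "curve_max f = residue f ` order_ge 1"
    by (simp add: kxy_max_eq)
  show "ideal_pow (curve_ring f) (curve_max f) n = residue f ` order_ge n"
    using kxy.quotient_ideal_pow[OF principal_ideal[of f] ideal_order_ge[of 1], of n]
      kxy_max_pow[where 'k = 'a, of n]
    unfolding eq curve_ring_def kxy_max_eq by simp
qed

lemma curve_principal_ideal:
  "genideal (curve_ring f) {residue f w} = residue f ` range ((*) w)"
  using kxy.quotient_genideal[OF principal_ideal[of f], of "{w}"]
  by (simp add: curve_ring_def principal_ideal_kxy)

lemma curve_ring_mult: "residue f s \<otimes>\<^bsub>curve_ring f\<^esub> residue f t = residue f (s * t)"
  using ideal.rcoset_mult_add[OF principal_ideal[of f], of s t]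
  by (simp add: curve_ring_def FactRing_def)

lemma cring_curve_ring: "cring (curve_ring f)"
  unfolding curve_ring_def by (rule ideal.quotient_is_cring[OF principal_ideal cring_kxy])

lemma ideal_curve_max: "ideal (curve_max f) (curve_ring f)"
  using kxy.ring_ideal_imp_quot_ideal[OF principal_ideal ideal_order_ge]
  by (simp add: curve_max_eq curve_ring_def)

theorem proposition3p3:
  fixes f :: "'k::field fps fps" and z :: "'k fps fps set" and e r :: nat
  assumes "f \<in> kxy_max"
    and "has_order kxy kxy_max f e"
    and "z \<in> curve_max f"
    and "has_order (curve_ring f) (curve_max f) z r"
    and "regular_element (assoc_graded (curve_ring f) (curve_max f))
           (initial_form (curve_ring f) (curve_max f) z)"
    and "loewy_witness (curve_ring f) (curve_max f) [z]"
  shows "gen_loewy_length (curve_ring f) (curve_max f) = r + e - 1"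
proof -
  let ?R = "curve_ring f" and ?m = "curve_max f"
  have f: "f \<in> order_ge e" "f \<notin> order_ge (Suc e)"
    using assms(2) by (simp_all add: has_order_def kxy_max_pow del: nat_pow_Suc)
  have z: "z \<in> residue f ` order_ge r" "z \<notin> residue f ` order_ge (Suc r)"
    using assms(4) by (simp_all add: has_order_def curve_max_pow del: nat_pow_Suc)
  obtain w where w: "w \<in> order_ge r" "w \<notin> order_ge (Suc r)" "z = residue f w"
    using z by blast
  have pos: "0 < e" "0 < r"
    using assms(1,3) f z by (auto simp: kxy_max_eq curve_max_eq intro!: gr0I)
  interpret regular_initial_form f w e r
  proof
    fix a b :: "'k fps fps" and i
    assume a: "a \<in> order_ge i" and wafb: "w * a + f * b \<in> order_ge (Suc (r + i))"
    \<comment> \<open>Multiples of \<open>f\<close> vanish in \<open>R\<close>, so \<open>z a\<close> has any order that some \<open>w a + f b\<close> has in \<open>S\<close>.\<close>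
    have "z \<otimes>\<^bsub>?R\<^esub> residue f a = residue f (w * a + f * b)"
      unfolding w(3) curve_ring_mult residue_eq_iff by (rule exI[of _ "- b"]) simp
    then have "z \<otimes>\<^bsub>?R\<^esub> residue f a \<in> ideal_pow ?R ?m (Suc (r + i))"
      using wafb unfolding curve_max_pow by simp
    moreover have "residue f a \<in> ideal_pow ?R ?m i"
      using a unfolding curve_max_pow by simp
    ultimately have "residue f a \<in> residue f ` order_ge (Suc i)"
      using cring.regular_initial_form_cancel[OF cring_curve_ring ideal_curve_max assms(4,5)]
      unfolding curve_max_pow by blast
    then obtain a' c where "a' \<in> order_ge (Suc i)" "a' = a + f * c"
      unfolding image_iff residue_eq_iff[of f a] by (metis residue_eq_iff)
    then show "\<exists>c. a + f * c \<in> order_ge (Suc i)"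
      by blast
  qed (use pos f w in auto)
  have sub_iff: "ideal_pow ?R ?m n \<subseteq> genideal ?R (set [z]) \<longleftrightarrow> order_ge n \<subseteq> combinations" for n
  proof -
    have mem: "residue f s \<in> residue f ` range ((*) w) \<longleftrightarrow> s \<in> combinations" for s
      by (auto simp: image_iff residue_eq_iff combinations_def)
    have "ideal_pow ?R ?m n \<subseteq> genideal ?R (set [z]) \<longleftrightarrow>
        residue f ` order_ge n \<subseteq> residue f ` range ((*) w)"
      by (simp only: curve_max_pow w(3) curve_principal_ideal list.set)
    also have "\<dots> \<longleftrightarrow> order_ge n \<subseteq> combinations"
      unfolding image_subset_iff mem by (rule subset_eq[symmetric])
    finally show ?thesis .
  qed
  let ?g = "gen_loewy_length ?R ?m"
  have sop: "system_of_parameters ?R ?m [z]"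
    and g: "order_ge ?g \<subseteq> combinations"
    using assms(6) sub_iff by (simp_all add: loewy_witness_def)
  have "?g \<le> r + e - 1"
    unfolding gen_loewy_length_def
  proof (rule Least_le, intro conjI exI[of _ "[z]"] sop)
    show "ideal_pow ?R ?m (r + e - 1) \<subseteq> genideal ?R (set [z])"
      unfolding sub_iff by (rule combinations_contain_order_ge[OF g])
  qed (use pos in simp)
  moreover have "\<not> Suc ?g < r + e"
    using not_all_combinations g by blast
  ultimately show ?thesis
    by simp
qed

end
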